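(* Let $m,n\in\mathbb{N}_0$ and let $s\ge 1$ be real. Then for all $x,y>0$, $$\left(\left|\beta^{(m)}(x)\right|+\left|\beta^{(n)}(y)\right|\right)^{\frac1s}\le\left|\beta^{(m)}(x)\right|^{\frac1s}+\left|\beta^{(n)}(y)\right|^{\frac1s}.$$
   Context: Nielsen's $\beta$-function is the function $\beta:(0,\infty)\to\mathbb{R}$ defined by $\beta(x)=\int_0^1 \frac{t^{x-1}}{1+t}\,dt=\int_0^\infty\frac{e^{-xt}}{1+e^{-t}}\,dt$ for $x>0$. For $m\in\mathbb{N}_0=\{0,1,2,\dots\}$, $\beta^{(m)}$ denotes its $m$-th derivative, with $\beta^{(0)}=\beta$. *)

theory Defs
  imports "HOL-Analysis.Analysis"
begin

text \<open>
  Nielsen's beta function, meaningful for \<open>x > 0\<close>. The endpoint \<open>t = 0\<close>, where the integrand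
  is singular for \<open>x < 1\<close>, is left out of the domain of integration; this also avoids the
  convention \<open>0 powr 0 = 0\<close>. The integrand is nonnegative, so the Henstock-Kurzweil integral
  agrees with the Lebesgue (and the improper Riemann) integral.

  Since \<open>{0<..}\<close> is open, iterating \<^const>\<open>deriv\<close> at a point \<open>x > 0\<close> depends only on the values
  of the function on \<open>{0<..}\<close>, so the values chosen for \<open>x \<le> 0\<close> play no role.
\<close>

definition nielsen_beta :: "real \<Rightarrow> real" where
  "nielsen_beta x = integral {0<..1} (\<lambda>t. t powr (x - 1) / (1 + t))"

end

theory Submission
  imports Defs
begin

text \<open>
  The two absolute values are nonnegative numbers and the exponent \<open>1 / s\<close> lies in \<open>{0<..1}\<close>, so
  the inequality is the subadditivity of a concave power function vanishing at \<open>0\<close>. This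
  subadditivity follows by homogeneity: after division by \<open>a + b\<close> it concerns two numbers of
  \<open>[0, 1]\<close> with sum \<open>1\<close>, and each of these is at most its own \<open>p\<close>-th power.
\<close>

lemma powr_add_le_add_powr:
  fixes a b p :: real
  assumes "a \<ge> 0" "b \<ge> 0" "0 \<le> p" "p \<le> 1"
  shows "(a + b) powr p \<le> a powr p + b powr p"
proof (cases "a + b = 0")
  case True
  then show ?thesis by simp
next
  case False
  define c where "c = a + b"
  have c: "c > 0" "a \<le> c" "b \<le> c"
    using False assms by (auto simp: c_def)
  have le_powr: "u \<le> u powr p" if "0 \<le> u" "u \<le> 1" for u :: real
    using powr_mono'[of p 1 u] that assms by simp
  have "1 = a / c + b / c"
    using c by (simp add: c_def flip: add_divide_distrib)
  also have "\<dots> \<le> (a / c) powr p + (b / c) powr p"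
    using c assms by (intro add_mono le_powr) auto
  also have "\<dots> = (a powr p + b powr p) / c powr p"
    using c assms by (simp add: powr_divide add_divide_distrib)
  finally show ?thesis
    using c by (simp add: field_simps flip: c_def)
qed

theorem theorem2p21:
  fixes m n :: nat and s :: real
  assumes "s \<ge> 1"
  shows "\<forall>x y :: real. x > 0 \<longrightarrow> y > 0 \<longrightarrow>
    (\<bar>(deriv ^^ m) nielsen_beta x\<bar> + \<bar>(deriv ^^ n) nielsen_beta y\<bar>) powr (1 / s)
      \<le> \<bar>(deriv ^^ m) nielsen_beta x\<bar> powr (1 / s) + \<bar>(deriv ^^ n) nielsen_beta y\<bar> powr (1 / s)"
  using assms by (intro allI impI powr_add_le_add_powr) auto

end
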